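(* Consider the single-agent contract problem with safety inspections described in the context, and suppose that $c_1<\dots<c_n$, $R_1<\dots<R_n$ (Assumption 1) and $\max_i(R_i-c_i)>\kappa_S$ (Assumption 2). Then, for every $j\in\{1,\dots,k\}$, the minimal inspection probability $\beta(\gamma)$ is a convex function of $\gamma$ over the interval $[\gamma_j,\gamma_{j+1}]$. Moreover, it is strictly convex there when $\beta(\gamma)>0$ (i.e. on the part of $[\gamma_j,\gamma_{j+1}]$ where $\beta(\gamma)>0$).
   Context: Single-agent model. An agent chooses an action $(a_i,s)$ with $i\in[n]:=\{1,\dots,n\}$ and $s\in\{0,1\}$. Actions with $s=1$ are called safe, actions with $s=0$ unsafe. Effort $a_i$ costs the agent $c_i\ge 0$ and taking $s=1$ costs an additional $\kappa_S\ge 0$. Effort $a_i$ has expected (nonnegative) reward $R_i\ge 0$ for the principal when the action is safe. When the action is unsafe, negative side effects (reward $-\infty$) occur with probability $\alpha\in(0,1]$. A linear contract is a pair $(\gamma,\beta)\in[0,1]^2$: $\gamma$ is the fraction of the reward paid to the agent (nothing is paid if side effects occur), and $\beta$ is the probability of an inspection that reveals $s$ (nothing is paid if the inspection reveals an unsafe action; inspection is independent of side effects). The agent's expected utility under $(\gamma,\beta)$ is $$\mathcal U_a(a_i,1)=\gamma R_i-c_i-\kappa_S,\qquad \mathcal U_a(a_i,0)=(1-\beta)(1-\alpha)\gamma R_i-c_i .$$ The contract $(\gamma,\beta)$ implements the action $(a_i,s)$ if (IC) $\mathcal U_a(a_i,s)\ge \mathcal U_a(a_j,s')$ for all $j\in[n]$,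 $s'\in\{0,1\}$, and (IR) $\mathcal U_a(a_i,s)\ge 0$. Notation. For $i\in[n]$ let $h_i(\gamma)=\gamma R_i-c_i$, and let $u_h(\gamma)=\max_{i\in[n]}h_i(\gamma)$ for $\gamma\in[0,1]$ (a piecewise linear function). Let $\gamma_1:=u_h^{-1}(\kappa_S)$ be the point with $u_h(\gamma_1)=\kappa_S$; no safe action is implementable with $\gamma<\gamma_1$. Let $\gamma_1<\gamma_2<\dots<\gamma_k<\gamma_{k+1}=1$ and $i_1<\dots<i_k$ be the subdivision of $[\gamma_1,1]$ into the linear pieces of $u_h$, i.e. $u_h=h_{i_j}$ on $[\gamma_j,\gamma_{j+1}]$ for $j=1,\dots,k$. For $\gamma\in[\gamma_1,1]$, $\beta(\gamma)\in[0,1]$ denotes the number such that $(\gamma,\beta)$ (with $\beta\in[0,1]$) implements some safe action if and only if $\beta\ge\beta(\gamma)$. *)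

theory Defs
  imports "HOL-Analysis.Analysis"
begin

text \<open>
  Parameters used throughout: efforts \<open>i \<in> {1..n}\<close> with cost \<open>c i\<close> and expected reward \<open>R i\<close>,
  additional cost \<open>\<kappa>\<close> of acting safely, and probability \<open>\<alpha>\<close> of side effects under an unsafe action.
  An action is a pair of an effort \<open>i\<close> and a flag \<open>s\<close>, where \<open>True\<close> means safe.
  A linear contract is a pair of a reward share \<open>g\<close> and an inspection probability \<open>b\<close>.
\<close>

text \<open>
  An unsafe agent is paid only if no side effects occur and no inspection takes place.
\<close>

definition agent_utility ::
  "(nat \<Rightarrow> real) \<Rightarrow> (nat \<Rightarrow> real) \<Rightarrow> real \<Rightarrow> real \<Rightarrow> real \<Rightarrow> real \<Rightarrow> nat \<Rightarrow> bool \<Rightarrow> real" where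
  "agent_utility c R \<alpha> \<kappa> g b i s =
     (if s then g * R i - c i - \<kappa> else (1 - b) * (1 - \<alpha>) * g * R i - c i)"

definition implements ::
  "nat \<Rightarrow> (nat \<Rightarrow> real) \<Rightarrow> (nat \<Rightarrow> real) \<Rightarrow> real \<Rightarrow> real \<Rightarrow> real \<Rightarrow> real \<Rightarrow> nat \<Rightarrow> bool \<Rightarrow> bool" where
  "implements n c R \<alpha> \<kappa> g b i s \<longleftrightarrow>
     (\<forall>j\<in>{1..n}. \<forall>s'. agent_utility c R \<alpha> \<kappa> g b i s \<ge> agent_utility c R \<alpha> \<kappa> g b j s') \<and>
     agent_utility c R \<alpha> \<kappa> g b i s \<ge> 0"

definition min_inspection ::
  "nat \<Rightarrow> (nat \<Rightarrow> real) \<Rightarrow> (nat \<Rightarrow> real) \<Rightarrow> real \<Rightarrow> real \<Rightarrow> real \<Rightarrow> real" where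
  "min_inspection n c R \<alpha> \<kappa> g =
     (THE b0. b0 \<in> {0..1} \<and>
        (\<forall>b\<in>{0..1}. (\<exists>i\<in>{1..n}. implements n c R \<alpha> \<kappa> g b i True) \<longleftrightarrow> b0 \<le> b))"

definition effort_utility :: "(nat \<Rightarrow> real) \<Rightarrow> (nat \<Rightarrow> real) \<Rightarrow> nat \<Rightarrow> real \<Rightarrow> real" where
  "effort_utility c R i g = g * R i - c i"

definition max_effort_utility :: "nat \<Rightarrow> (nat \<Rightarrow> real) \<Rightarrow> (nat \<Rightarrow> real) \<Rightarrow> real \<Rightarrow> real" where
  "max_effort_utility n c R g = Max ((\<lambda>i. effort_utility c R i g) ` {1..n})"

text \<open>
  The breakpoints are \<open>\<gamma> 1 < \<dots> < \<gamma> (k + 1) = 1\<close>, and on \<open>{\<gamma> j..\<gamma> (j + 1)}\<close> the maximum is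
  attained by effort \<open>\<iota> j\<close>. When rewards are strictly increasing in the effort, strict monotonicity
  of \<open>\<iota>\<close> makes consecutive slopes differ, so these are the maximal linear pieces.
  The starting point \<open>\<gamma> 1\<close> is determined by its defining equation except in the degenerate case
  \<open>\<kappa> = c 1 = R 1 = 0\<close>; there every solution is admitted as starting point, including the least
  one, below which no safe action can be implemented.
\<close>

definition linear_pieces ::
  "nat \<Rightarrow> (nat \<Rightarrow> real) \<Rightarrow> (nat \<Rightarrow> real) \<Rightarrow> real \<Rightarrow> nat \<Rightarrow> (nat \<Rightarrow> real) \<Rightarrow> (nat \<Rightarrow> nat) \<Rightarrow> bool" where
  "linear_pieces n c R \<kappa> k \<gamma> \<iota> \<longleftrightarrow>
     \<gamma> 1 \<in> {0..1} \<and> max_effort_utility n c R (\<gamma> 1) = \<kappa> \<and> \<gamma> (k + 1) = 1 \<and>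
     strict_mono_on {1..k + 1} \<gamma> \<and> strict_mono_on {1..k} \<iota> \<and> \<iota> ` {1..k} \<subseteq> {1..n} \<and>
     (\<forall>j\<in>{1..k}. \<forall>g\<in>{\<gamma> j..\<gamma> (j + 1)}.
        max_effort_utility n c R g = effort_utility c R (\<iota> j) g)"

text \<open>As for \<^const>\<open>convex_on\<close>, the domain itself is required to be convex.\<close>

definition strictly_convex_on :: "real set \<Rightarrow> (real \<Rightarrow> real) \<Rightarrow> bool" where
  "strictly_convex_on S f \<longleftrightarrow> convex S \<and>
     (\<forall>x\<in>S. \<forall>y\<in>S. \<forall>t. x \<noteq> y \<and> 0 < t \<and> t < 1 \<longrightarrow>
        f ((1 - t) * x + t * y) < (1 - t) * f x + t * f y)"

end

theory Submission
  imports Defs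
begin

text \<open>
  A safe action is implementable iff \<open>u g \<ge> \<kappa>\<close> and \<open>u x \<le> u g - \<kappa>\<close>, where \<open>u\<close> is the maximal effort
  utility and \<open>x = (1 - b) (1 - \<alpha>) g\<close> is the effective share of an unsafe agent. Let \<open>u = h\<^sub>i\<close> on the
  given piece. Efforts \<open>j > i\<close> impose no constraint: \<open>h\<^sub>i x \<le> h\<^sub>i g - \<kappa>\<close> gives \<open>x \<le> g - \<kappa> / R\<^sub>i\<close>, whence
  \<open>h\<^sub>j x \<le> h\<^sub>j g - \<kappa> R\<^sub>j / R\<^sub>i \<le> h\<^sub>i g - \<kappa>\<close>. Neither do efforts with \<open>R\<^sub>j = 0\<close>. For the other \<open>j \<le> i\<close> the constraint \<open>h\<^sub>j x \<le> h\<^sub>i g - \<kappa>\<close> reads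
  \<open>b \<ge> A\<^sub>j + B\<^sub>j / g\<close> with \<open>B\<^sub>j = (c\<^sub>i + \<kappa> - c\<^sub>j) / ((1 - \<alpha>) R\<^sub>j)\<close>, which is positive if \<open>\<kappa> > 0\<close>. So the
  minimal inspection probability is the maximum of 0 and finitely many strictly convex decreasing
  functions. If \<open>\<kappa> = 0\<close> or \<open>\<alpha> = 1\<close>, no inspection is needed.
\<close>

section \<open>Maximal effort utility and implementability of safe actions\<close>

lemma max_effort_utility_le_iff:
  assumes "n \<ge> 1"
  shows "max_effort_utility n c R g \<le> v \<longleftrightarrow> (\<forall>j\<in>{1..n}. effort_utility c R j g \<le> v)"
  using assms unfolding max_effort_utility_def by (subst Max_le_iff) auto

lemma effort_utility_le_max:
  assumes "j \<in> {1..n}"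
  shows "effort_utility c R j g \<le> max_effort_utility n c R g"
  using assms unfolding max_effort_utility_def by (intro Max_ge) auto

lemma max_effort_utility_attained:
  assumes "n \<ge> 1"
  obtains i where "i \<in> {1..n}" "max_effort_utility n c R g = effort_utility c R i g"
proof -
  have "max_effort_utility n c R g \<in> (\<lambda>i. effort_utility c R i g) ` {1..n}"
    unfolding max_effort_utility_def using assms by (intro Max_in) auto
  then show ?thesis using that by auto
qed

lemma max_effort_utility_mono:
  assumes "n \<ge> 1" "\<And>i. i \<in> {1..n} \<Longrightarrow> 0 \<le> R i" "x \<le> y"
  shows "max_effort_utility n c R x \<le> max_effort_utility n c R y"
proof -
  have "effort_utility c R j x \<le> max_effort_utility n c R y" if "j \<in> {1..n}" for j
  proof -
    have "effort_utility c R j x \<le> effort_utility c R j y"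
      using assms that by (simp add: effort_utility_def mult_right_mono)
    with effort_utility_le_max[OF that, of c R y] show ?thesis by linarith
  qed
  then show ?thesis using assms(1) by (simp add: max_effort_utility_le_iff)
qed

text \<open>Safe deviations force \<open>i\<close> to maximise effort utility at \<open>g\<close>,
  so every implemented safe action yields the maximum less \<open>\<kappa>\<close>. The best unsafe
  deviation yields the maximal effort utility at the share
  \<open>(1 - b) * (1 - \<alpha>) * g\<close>.\<close>

lemma implements_safe_iff:
  assumes "n \<ge> 1" "0 \<le> \<kappa>"
  shows "(\<exists>i\<in>{1..n}. implements n c R \<alpha> \<kappa> g b i True) \<longleftrightarrow>
    \<kappa> \<le> max_effort_utility n c R g \<and>
    max_effort_utility n c R ((1 - b) * (1 - \<alpha>) * g) \<le> max_effort_utility n c R g - \<kappa>"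
    (is "?L \<longleftrightarrow> ?R")
proof -
  have safe: "agent_utility c R \<alpha> \<kappa> g b i True = effort_utility c R i g - \<kappa>" for i
    by (simp add: agent_utility_def effort_utility_def)
  have unsafe: "agent_utility c R \<alpha> \<kappa> g b i False = effort_utility c R i ((1 - b) * (1 - \<alpha>) * g)" for i
    by (simp add: agent_utility_def effort_utility_def)
  have impl: "implements n c R \<alpha> \<kappa> g b i True \<longleftrightarrow>
      max_effort_utility n c R g \<le> effort_utility c R i g \<and>
      max_effort_utility n c R ((1 - b) * (1 - \<alpha>) * g) \<le> effort_utility c R i g - \<kappa> \<and>
      \<kappa> \<le> effort_utility c R i g" for i
    unfolding implements_def all_bool_eq safe unsafe max_effort_utility_le_iff[OF assms(1)] by auto
  show ?thesis
  proof
    assume ?L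
    then obtain i where i: "i \<in> {1..n}" and I: "implements n c R \<alpha> \<kappa> g b i True" by blast
    show ?R using I effort_utility_le_max[OF i, of c R g] unfolding impl by linarith
  next
    assume r: ?R
    obtain i where i: "i \<in> {1..n}" "max_effort_utility n c R g = effort_utility c R i g"
      using max_effort_utility_attained[OF assms(1)] .
    have "implements n c R \<alpha> \<kappa> g b i True" using r unfolding impl i(2) by simp
    with i(1) show ?L by blast
  qed
qed

section \<open>The minimal inspection probability as a threshold\<close>

lemma min_inspection_eqI:
  assumes "n \<ge> 1" "0 \<le> \<kappa>" "\<kappa> \<le> max_effort_utility n c R g" "b0 \<in> {0..1}"
    and "\<And>b. b \<in> {0..1} \<Longrightarrow>
      max_effort_utility n c R ((1 - b) * (1 - \<alpha>) * g) \<le> max_effort_utility n c R g - \<kappa> \<longleftrightarrow> b0 \<le> b"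
  shows "min_inspection n c R \<alpha> \<kappa> g = b0"
  unfolding min_inspection_def
proof (rule the_equality)
  have iff: "(\<exists>i\<in>{1..n}. implements n c R \<alpha> \<kappa> g b i True) \<longleftrightarrow> b0 \<le> b" if "b \<in> {0..1}" for b
    using assms(3,5) that implements_safe_iff[OF assms(1,2)] by simp
  then show "b0 \<in> {0..1} \<and> (\<forall>b\<in>{0..1}. (\<exists>i\<in>{1..n}. implements n c R \<alpha> \<kappa> g b i True) \<longleftrightarrow> b0 \<le> b)"
    using assms(4) by blast
  fix b1
  assume "b1 \<in> {0..1} \<and> (\<forall>b\<in>{0..1}. (\<exists>i\<in>{1..n}. implements n c R \<alpha> \<kappa> g b i True) \<longleftrightarrow> b1 \<le> b)"
  \<comment> \<open>Each threshold lies in the unit interval, so it can be tested against the other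
    one; this gives both inequalities.\<close>
  then show "b1 = b0" using iff assms(4) by (metis order_refl order_antisym)
qed

text \<open>If \<open>\<kappa>\<close> = 0, the unsafe share never exceeds \<open>g\<close> and
  monotonicity suffices. If \<open>\<alpha>\<close> = 1, an unsafe agent is never paid and gains at
  most 0.\<close>

lemma min_inspection_eq_0:
  assumes "n \<ge> 1" "0 < \<alpha>" "\<alpha> \<le> 1" "0 \<le> \<kappa>"
    and "\<And>i. i \<in> {1..n} \<Longrightarrow> 0 \<le> c i" "\<And>i. i \<in> {1..n} \<Longrightarrow> 0 \<le> R i"
    and "\<kappa> = 0 \<or> \<alpha> = 1" "0 \<le> g" "\<kappa> \<le> max_effort_utility n c R g"
  shows "min_inspection n c R \<alpha> \<kappa> g = 0"
proof (rule min_inspection_eqI)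
  fix b :: real assume b: "b \<in> {0..1}"
  have "max_effort_utility n c R ((1 - b) * (1 - \<alpha>) * g) \<le> max_effort_utility n c R g - \<kappa>"
  proof (cases "\<kappa> = 0")
    case True
    have "(1 - b) * (1 - \<alpha>) \<le> 1" using b assms(2,3) by (intro mult_le_one) auto
    then have "(1 - b) * (1 - \<alpha>) * g \<le> g" using assms(8) mult_right_mono[of _ 1 g] by simp
    with True max_effort_utility_mono[of n R] assms(1,6) show ?thesis by simp
  next
    case False
    then have "max_effort_utility n c R ((1 - b) * (1 - \<alpha>) * g) \<le> 0"
      using assms(1,5,7) by (simp add: max_effort_utility_le_iff effort_utility_def)
    with assms(9) show ?thesis by linarith
  qed
  with b show "max_effort_utility n c R ((1 - b) * (1 - \<alpha>) * g) \<le> max_effort_utility n c R g - \<kappa> \<longleftrightarrow> 0 \<le> b"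
    by simp
qed (use assms in auto)

text \<open>Solves the condition that deters unsafe deviations for \<open>b\<close>: each binding
  effort contributes an explicit lower bound, a constant plus a multiple of
  \<open>1 / g\<close>.\<close>

lemma max_unsafe_utility_le_iff:
  assumes "n \<ge> 1" "\<alpha> < 1" "0 < \<kappa>" "0 < g" "i \<in> {1..n}"
    and c: "\<And>j. j \<in> {1..n} \<Longrightarrow> 0 \<le> c j" and R: "\<And>j. j \<in> {1..n} \<Longrightarrow> 0 \<le> R j"
    and Rmono: "strict_mono_on {1..n} R"
    and u: "max_effort_utility n c R g = effort_utility c R i g" "\<kappa> \<le> effort_utility c R i g"
  shows "max_effort_utility n c R ((1 - b) * (1 - \<alpha>) * g) \<le> effort_utility c R i g - \<kappa> \<longleftrightarrow>
    (\<forall>j\<in>{j \<in> {1..i}. 0 < R j}.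
      1 - R i / ((1 - \<alpha>) * R j) + (c i + \<kappa> - c j) / ((1 - \<alpha>) * R j) / g \<le> b)"
    (is "?L \<longleftrightarrow> ?R")
proof -
  define x where "x = (1 - b) * (1 - \<alpha>) * g"
  have key: "effort_utility c R j x \<le> effort_utility c R i g - \<kappa> \<longleftrightarrow>
      1 - R i / ((1 - \<alpha>) * R j) + (c i + \<kappa> - c j) / ((1 - \<alpha>) * R j) / g \<le> b"
    if "0 < R j" for j
  proof -
    define d where "d = (1 - \<alpha>) * R j"
    have d: "0 < d" unfolding d_def using that assms(2) by simp
    have "1 - R i / d + (c i + \<kappa> - c j) / d / g = 1 - (g * R i - c i - \<kappa> + c j) / (d * g)"
      using d assms(4) by (simp add: field_simps)
    also have "\<dots> \<le> b \<longleftrightarrow> (1 - b) * (d * g) \<le> g * R i - c i - \<kappa> + c j"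
      using d assms(4) by (simp add: field_simps)
    also have "(1 - b) * (d * g) = x * R j" by (simp add: x_def d_def mult_ac)
    finally show ?thesis unfolding effort_utility_def d_def by auto
  qed
  have "g * R i > 0" using u(2) assms(3) c[OF assms(5)] by (simp add: effort_utility_def)
  then have Ri: "0 < R i" using assms(4) by (simp add: zero_less_mult_iff)
  have up: "effort_utility c R j x \<le> effort_utility c R i g - \<kappa>"
    if j: "j \<in> {1..n}" "i < j" and i: "effort_utility c R i x \<le> effort_utility c R i g - \<kappa>" for j
  proof -
    have RR: "R i \<le> R j" using strict_mono_on_leD[OF Rmono assms(5) j(1)] j(2) by simp
    have k: "\<kappa> \<le> (g - x) * R i" using i by (simp add: effort_utility_def algebra_simps)
    \<comment> \<open>A positive loss together with \<open>R i\<close> > 0 fixes the sign of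
      \<open>g - x\<close>, so a larger slope can only increase the loss.\<close>
    then have "0 < (g - x) * R i" using assms(3) by linarith
    then have "0 \<le> g - x" using Ri by (simp add: zero_less_mult_iff)
    then have "(g - x) * R i \<le> (g - x) * R j" using RR by (rule mult_left_mono[rotated])
    with k have "effort_utility c R j x \<le> effort_utility c R j g - \<kappa>"
      by (simp add: effort_utility_def algebra_simps)
    with effort_utility_le_max[OF j(1), of c R g] u(1) show ?thesis by linarith
  qed
  have "?L \<longleftrightarrow> (\<forall>j\<in>{1..n}. effort_utility c R j x \<le> effort_utility c R i g - \<kappa>)"
    unfolding x_def using assms(1) by (rule max_effort_utility_le_iff)
  also have "\<dots> \<longleftrightarrow> (\<forall>j\<in>{j \<in> {1..i}. 0 < R j}. effort_utility c R j x \<le> effort_utility c R i g - \<kappa>)"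
    (is "_ \<longleftrightarrow> ?M")
  proof
    assume M: ?M
    show "\<forall>j\<in>{1..n}. effort_utility c R j x \<le> effort_utility c R i g - \<kappa>"
    proof
      fix j assume j: "j \<in> {1..n}"
      consider "0 < R j" "j \<le> i" | "i < j" | "R j = 0" using R[OF j] by linarith
      then show "effort_utility c R j x \<le> effort_utility c R i g - \<kappa>"
      proof cases
        case 1 then show ?thesis using M j by simp
      next
        \<comment> \<open>The bound at \<open>i\<close> itself comes from \<open>M\<close>, as
          \<open>R i\<close> > 0 puts \<open>i\<close> into the index set.\<close>
        case 2 then show ?thesis using up j M Ri assms(5) by simp
      next
        case 3
        then have "effort_utility c R j x \<le> 0" using c[OF j] by (simp add: effort_utility_def)
        with u(2) show ?thesis by linarith
      qed
    qed
  qed (use assms(5) in auto)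
  also have "\<dots> \<longleftrightarrow> ?R" using key by auto
  finally show ?thesis .
qed

section \<open>Convexity of maxima of hyperbolas\<close>

lemma convex_on_cong:
  assumes "\<And>x. x \<in> S \<Longrightarrow> f x = g x"
  shows "convex_on S f \<longleftrightarrow> convex_on S g"
proof -
  have "u *\<^sub>R x + v *\<^sub>R y \<in> S"
    if "convex S" "x \<in> S" "y \<in> S" "0 \<le> u" "0 \<le> v" "u + v = 1" for x y u v
    using that by (simp add: convexD)
  with assms show ?thesis unfolding convex_on_def by auto
qed

text \<open>The gap between the two sides is computed explicitly; its numerator contains the factor
  \<open>(x - y)\<^sup>2\<close>.\<close>

lemma divide_strictly_convex:
  fixes x y t B :: real
  assumes "0 < x" "0 < y" "x \<noteq> y" "0 < t" "t < 1" "0 < B"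
  shows "B / ((1 - t) * x + t * y) < (1 - t) * (B / x) + t * (B / y)"
proof -
  define z where "z = (1 - t) * x + t * y"
  have z: "0 < z" unfolding z_def using assms by (simp add: add_pos_pos)
  have "((1 - t) * (B / x) + t * (B / y)) - B / z = B * (t * (1 - t) * (x - y)\<^sup>2) / (x * y * z)"
    unfolding z_def using assms z[unfolded z_def]
    by (simp add: divide_simps) (simp add: power2_eq_square algebra_simps)
  also have "\<dots> > 0" using assms z by simp
  finally show ?thesis unfolding z_def by simp
qed

text \<open>Every hyperbola satisfies the strict inequality, which survives a finite maximum. The
  constant 0 satisfies only the weak one, unless \<open>f\<close> is positive at the end
  points.\<close>

lemma Max_divide_convex:
  fixes A B :: "'a \<Rightarrow> real" and J :: "'a set" and f :: "real \<Rightarrow> real"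
  defines "f \<equiv> \<lambda>g. Max (insert 0 ((\<lambda>j. A j + B j / g) ` J))"
  assumes J: "finite J" and B: "\<And>j. j \<in> J \<Longrightarrow> 0 < B j" and lu: "0 < l"
  shows "convex_on {l..u} f" "strictly_convex_on {g \<in> {l..u}. f g > 0} f"
proof -
  have ge: "0 \<le> f g" "j \<in> J \<Longrightarrow> A j + B j / g \<le> f g" for g j
    unfolding f_def using J by (auto intro!: Max_ge)
  have le: "f g \<le> v \<longleftrightarrow> 0 \<le> v \<and> (\<forall>j\<in>J. A j + B j / g \<le> v)" for g v
    unfolding f_def using J by (subst Max_le_iff) auto
  have less: "f g < v \<longleftrightarrow> 0 < v \<and> (\<forall>j\<in>J. A j + B j / g < v)" for g v
    unfolding f_def using J by (subst Max_less_iff) auto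
  have less_convex: "A j + B j / ((1 - t) * x + t * y) < (1 - t) * f x + t * f y"
    if "j \<in> J" "x \<in> {l..u}" "y \<in> {l..u}" "0 < t" "t < 1" "x \<noteq> y" for j x y t
  proof -
    have "A j + B j / ((1 - t) * x + t * y) < A j + ((1 - t) * (B j / x) + t * (B j / y))"
      using divide_strictly_convex[of x y t "B j"] that B lu by simp
    also have "\<dots> = (1 - t) * (A j + B j / x) + t * (A j + B j / y)"
      by (simp add: algebra_simps)
    also have "\<dots> \<le> (1 - t) * f x + t * f y"
      using ge(2) that by (intro add_mono mult_left_mono) auto
    finally show ?thesis .
  qed
  show "convex_on {l..u} f"
  proof (rule convex_onI)
    fix t x y :: real assume txy: "0 < t" "t < 1" "x \<in> {l..u}" "y \<in> {l..u}"
    show "f ((1 - t) *\<^sub>R x + t *\<^sub>R y) \<le> (1 - t) * f x + t * f y"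
    proof (cases "x = y")
      case True
      then show ?thesis by (simp add: algebra_simps)
    next
      case False
      then show ?thesis using txy less_convex ge(1) by (auto simp: le intro!: less_imp_le)
    qed
  qed simp
  \<comment> \<open>Strict convexity includes convexity of the domain: since \<open>f\<close>
    decreases, the points where it is positive form an interval.\<close>
  have antimono: "f y \<le> f x" if "0 < x" "x \<le> y" for x y
  proof -
    have "A j + B j / y \<le> f x" if "j \<in> J" for j
    proof -
      have "B j / y \<le> B j / x"
        using B[OF that] \<open>0 < x\<close> \<open>x \<le> y\<close> by (intro divide_left_mono) auto
      with ge(2)[OF that, of x] show ?thesis by linarith
    qed
    with ge(1) show ?thesis by (simp add: le)
  qed
  have "is_interval {g \<in> {l..u}. f g > 0}"
    unfolding is_interval_1 using lu by (auto intro: less_le_trans[OF _ antimono])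
  then show "strictly_convex_on {g \<in> {l..u}. f g > 0} f"
    unfolding strictly_convex_on_def is_interval_convex_1 using less_convex
    by (auto simp: less intro!: add_pos_pos)
qed

theorem lemma3:
  fixes n k :: nat and c R \<gamma> :: "nat \<Rightarrow> real" and \<iota> :: "nat \<Rightarrow> nat" and \<alpha> \<kappa> :: real
  assumes "n \<ge> 1"
    and "0 < \<alpha>" and "\<alpha> \<le> 1" and "0 \<le> \<kappa>"
    and "\<And>i. i \<in> {1..n} \<Longrightarrow> 0 \<le> c i" and "\<And>i. i \<in> {1..n} \<Longrightarrow> 0 \<le> R i"
    and assumption1: "strict_mono_on {1..n} c" "strict_mono_on {1..n} R"
    and assumption2: "Max ((\<lambda>i. R i - c i) ` {1..n}) > \<kappa>"
    and "linear_pieces n c R \<kappa> k \<gamma> \<iota>"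
  shows "\<forall>j\<in>{1..k}.
    convex_on {\<gamma> j..\<gamma> (j + 1)} (min_inspection n c R \<alpha> \<kappa>) \<and>
    strictly_convex_on {g \<in> {\<gamma> j..\<gamma> (j + 1)}. min_inspection n c R \<alpha> \<kappa> g > 0}
      (min_inspection n c R \<alpha> \<kappa>)"
proof
  fix p assume p: "p \<in> {1..k}"
  note lp = assms(10)[unfolded linear_pieces_def]
  define i where "i = \<iota> p"
  define S where "S = {\<gamma> p..\<gamma> (p + 1)}"
  let ?\<beta> = "min_inspection n c R \<alpha> \<kappa>"
  have i: "i \<in> {1..n}" using lp p unfolding i_def by blast
  have u: "max_effort_utility n c R g = effort_utility c R i g" if "g \<in> S" for g
    using lp p that unfolding i_def S_def by blast
  have "\<gamma> 1 \<le> \<gamma> p"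
  proof (cases "p = 1")
    case False
    then have "\<gamma> 1 < \<gamma> p" using lp p strict_mono_onD[of "{1..k+1}" \<gamma> 1 p] by auto
    then show ?thesis by simp
  qed simp
  then have "\<gamma> 1 \<le> g" if "g \<in> S" for g using that unfolding S_def by auto
  \<comment> \<open>The value \<open>\<kappa>\<close> at the first breakpoint propagates to the
    right by monotonicity.\<close>
  then have ge: "\<kappa> \<le> max_effort_utility n c R g" if "g \<in> S" for g
    using max_effort_utility_mono[of n R "\<gamma> 1" g c] assms(1,6) lp that by simp
  have \<gamma>p: "0 \<le> \<gamma> p" using \<open>\<gamma> 1 \<le> \<gamma> p\<close> lp by auto
  have "convex_on S ?\<beta> \<and> strictly_convex_on {g \<in> S. ?\<beta> g > 0} ?\<beta>"
  proof (cases "\<kappa> = 0 \<or> \<alpha> = 1")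
    case True
    have z: "?\<beta> g = 0" if "g \<in> S" for g
      using min_inspection_eq_0[OF assms(1-6) True _ ge[OF that]] that \<gamma>p unfolding S_def by auto
    then have empty: "{g \<in> S. ?\<beta> g > 0} = {}" by auto
    have "convex_on S ?\<beta>"
      using convex_on_cong[of S ?\<beta> "\<lambda>_. 0"] z by (simp add: convex_on_const S_def)
    then show ?thesis unfolding empty by (simp add: strictly_convex_on_def)
  next
    case False
    then have \<kappa>: "0 < \<kappa>" and \<alpha>: "\<alpha> < 1" using assms(3,4) by auto
    define J where "J = {j \<in> {1..i}. 0 < R j}"
    define A where "A j = 1 - R i / ((1 - \<alpha>) * R j)" for j
    define B where "B j = (c i + \<kappa> - c j) / ((1 - \<alpha>) * R j)" for j
    define f where "f g = Max (insert 0 ((\<lambda>j. A j + B j / g) ` J))" for g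
    have J: "finite J" unfolding J_def by simp
    \<comment> \<open>Increasing costs and \<open>\<kappa>\<close> > 0 make the numerators in
      \<open>B\<close> positive.\<close>
    have cle: "c j \<le> c i" if "j \<in> J" for j
      using that i strict_mono_on_leD[OF assumption1(1), of j i] unfolding J_def by auto
    have B: "0 < B j" if "j \<in> J" for j
      using cle[OF that] that \<kappa> \<alpha> unfolding B_def J_def by auto
    \<comment> \<open>At share 0 no effort has positive utility, whereas \<open>\<kappa>\<close> > 0
      must be reached on \<open>S\<close>; hence division by \<open>g\<close> is safe.\<close>
    have \<gamma>p': "0 < \<gamma> p"
    proof (rule ccontr)
      assume "\<not> 0 < \<gamma> p"
      with \<gamma>p have "\<gamma> p = 0" by simp
      moreover have "\<gamma> p \<in> S"
        using strict_mono_onD[of "{1..k+1}" \<gamma> p "p+1"] lp p unfolding S_def by auto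
      ultimately show False using ge[of 0] u[of 0] \<kappa> assms(5)[OF i] by (simp add: effort_utility_def)
    qed
    have eq: "?\<beta> g = f g" if g: "g \<in> S" for g
    proof (rule min_inspection_eqI[OF assms(1,4) ge[OF g]])
      have g0: "0 < g" using g \<gamma>p' unfolding S_def by auto
      have iff: "max_effort_utility n c R ((1 - b) * (1 - \<alpha>) * g) \<le> max_effort_utility n c R g - \<kappa>
          \<longleftrightarrow> (\<forall>j\<in>J. A j + B j / g \<le> b)" for b
        unfolding u[OF g] J_def A_def B_def
        using max_unsafe_utility_le_iff[OF assms(1) \<alpha> \<kappa> g0 i assms(5,6) assumption1(2) u[OF g]]
          ge[OF g] u[OF g] by simp
      have f_le: "f g \<le> v \<longleftrightarrow> 0 \<le> v \<and> (\<forall>j\<in>J. A j + B j / g \<le> v)" for v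
        unfolding f_def using J by (subst Max_le_iff) auto
      \<comment> \<open>Certain inspection leaves an unsafe agent with share 0, so \<open>b\<close>
        = 1 meets all lower bounds.\<close>
      have "max_effort_utility n c R 0 \<le> 0"
        using assms(1,5) by (simp add: max_effort_utility_le_iff effort_utility_def)
      then have "f g \<le> 1" using iff[of 1] ge[OF g] by (simp add: f_le)
      moreover have "0 \<le> f g" unfolding f_def using J by simp
      ultimately show "f g \<in> {0..1}" by simp
      fix b :: real assume "b \<in> {0..1}"
      then show "max_effort_utility n c R ((1 - b) * (1 - \<alpha>) * g) \<le> max_effort_utility n c R g - \<kappa>
          \<longleftrightarrow> f g \<le> b"
        using iff f_le by simp
    qed
    have f: "convex_on S f" "strictly_convex_on {g \<in> S. f g > 0} f"
      using Max_divide_convex[OF J B \<gamma>p', where A = A] unfolding f_def S_def by auto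
    have pos: "{g \<in> S. ?\<beta> g > 0} = {g \<in> S. f g > 0}" using eq by auto
    \<comment> \<open>Replacing \<open>f\<close> by \<open>?\<beta>\<close> in the strict inequality
      also requires the intermediate point to lie in the set where they agree.\<close>
    have mem: "(1 - t) * x + t * y \<in> {g \<in> S. f g > 0}"
      if "x \<in> {g \<in> S. f g > 0}" "y \<in> {g \<in> S. f g > 0}" "0 < t" "t < 1" for x y t
      using convexD_alt[of "{g \<in> S. f g > 0}" x y t] f(2) that
      unfolding strictly_convex_on_def by auto
    have "strictly_convex_on {g \<in> S. f g > 0} ?\<beta>"
      using f(2) mem eq unfolding strictly_convex_on_def by auto
    moreover have "convex_on S ?\<beta>" using f(1) eq convex_on_cong[of S ?\<beta> f] by simp
    ultimately show ?thesis unfolding pos by simp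
  qed
  then show "convex_on {\<gamma> p..\<gamma> (p + 1)} ?\<beta> \<and>
    strictly_convex_on {g \<in> {\<gamma> p..\<gamma> (p + 1)}. ?\<beta> g > 0} ?\<beta>"
    unfolding S_def .
qed

end
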